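(* Let $G$ be a finite simple graph with $\delta(G)\geq 1$ and let $M(G)$ be its Mycielskian. Then $G$ belongs to Class 1 if and only if $\chi_d^t(M(G))=\chi_d^t(G)+1$.
   Context: All graphs are finite, undirected and simple. A total dominator coloring (TDC) of $G$ is a proper coloring of $G$ in which every vertex of $G$ is adjacent to every vertex of some color class; $\chi_d^t(G)$ is the minimum number of color classes in a TDC of $G$, and a $\chi_d^t$-coloring is a TDC with $\chi_d^t(G)$ colors. For a TDC $f=(V_1,\dots,V_\ell)$ (with $V_i$ the color classes), write $v\succ V_i$ if $v$ is adjacent to all vertices of $V_i$. A vertex $v$ is a private neighbor of $V_i$ with respect to $f$ if $v\succ V_i$ and $v\not\succ V_j$ for all $j\neq i$; the set of these is $pn_G(V_i;f)$. $G$ belongs to Class 1 if it has a $\chi_d^t$-coloring $f=(V_1,\dots,V_\ell)$ with $pn_G(V_i;f)=\emptyset$ for some $i$, and to Class 2 otherwise. If $V(G)=\{v_1,\dots,v_n\}$, the Mycielskian $M(G)$ has vertex set $V(G)\cup\{u_1,\dots,u_n\}\cup\{w\}$ and edge set $E(G)\cup\{u_iv_j : v_iv_j\in E(G)\}\cup\{u_iw : 1\le i\le n\}$. *)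

theory Defs
  imports Main "HOL-Library.Disjoint_Sets"
begin

record 'a ugraph =
  verts :: "'a set"
  edges :: "'a set set"

definition simple_graph :: "'a ugraph \<Rightarrow> bool" where
  "simple_graph G \<longleftrightarrow>
     finite (verts G) \<and> (\<forall>e\<in>edges G. e \<subseteq> verts G \<and> card e = 2)"

definition adj :: "'a ugraph \<Rightarrow> 'a \<Rightarrow> 'a \<Rightarrow> bool" where
  "adj G u v \<longleftrightarrow> {u, v} \<in> edges G"

definition degree :: "'a ugraph \<Rightarrow> 'a \<Rightarrow> nat" where
  "degree G v = card {u \<in> verts G. adj G v u}"

text \<open>Only meaningful for finite graphs with at least one vertex.\<close>

definition min_degree :: "'a ugraph \<Rightarrow> nat" where
  "min_degree G = Min (degree G ` verts G)"

text \<open>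
  A coloring is represented by the set of its color classes, i.e. by a partition of the
  vertex set. In particular color classes are nonempty, and the number of colors used is the
  cardinality of the partition.
\<close>

definition proper_coloring :: "'a ugraph \<Rightarrow> 'a set set \<Rightarrow> bool" where
  "proper_coloring G f \<longleftrightarrow>
     partition_on (verts G) f \<and> (\<forall>C\<in>f. \<forall>u\<in>C. \<forall>v\<in>C. \<not> adj G u v)"

definition dominates :: "'a ugraph \<Rightarrow> 'a \<Rightarrow> 'a set \<Rightarrow> bool" where
  "dominates G v C \<longleftrightarrow> (\<forall>u\<in>C. adj G v u)"

definition total_dominator_coloring :: "'a ugraph \<Rightarrow> 'a set set \<Rightarrow> bool" where
  "total_dominator_coloring G f \<longleftrightarrow>
     proper_coloring G f \<and> (\<forall>v\<in>verts G. \<exists>C\<in>f. dominates G v C)"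

text \<open>
  Unspecified if there is no total dominator coloring. A finite simple graph without isolated
  vertices has one, namely the partition into singletons.
\<close>

definition td_chromatic_number :: "'a ugraph \<Rightarrow> nat" where
  "td_chromatic_number G = (LEAST k. \<exists>f. total_dominator_coloring G f \<and> card f = k)"

definition min_td_coloring :: "'a ugraph \<Rightarrow> 'a set set \<Rightarrow> bool" where
  "min_td_coloring G f \<longleftrightarrow>
     total_dominator_coloring G f \<and> card f = td_chromatic_number G"

definition private_neighbors :: "'a ugraph \<Rightarrow> 'a set \<Rightarrow> 'a set set \<Rightarrow> 'a set" where
  "private_neighbors G C f =
     {v \<in> verts G. dominates G v C \<and> (\<forall>D\<in>f. D \<noteq> C \<longrightarrow> \<not> dominates G v D)}"

definition class1 :: "'a ugraph \<Rightarrow> bool" where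
  "class1 G \<longleftrightarrow> (\<exists>f. min_td_coloring G f \<and> (\<exists>C\<in>f. private_neighbors G C f = {}))"

text \<open>
  Vertices of the Mycielskian: \<open>Orig v\<^sub>i\<close> is $v_i$, \<open>Copy v\<^sub>i\<close> is $u_i$, \<open>Apex\<close> is $w$.
\<close>

datatype 'a myc_vertex = Orig 'a | Copy 'a | Apex

text \<open>
  In the second edge set both ordered pairs for an edge occur, so an edge $v_i v_j$ gives
  both $u_i v_j$ and $u_j v_i$.
\<close>

definition mycielskian :: "'a ugraph \<Rightarrow> 'a myc_vertex ugraph" where
  "mycielskian G =
     \<lparr> verts = Orig ` verts G \<union> Copy ` verts G \<union> {Apex},
       edges = {{Orig x, Orig y} | x y. {x, y} \<in> edges G}
             \<union> {{Copy x, Orig y} | x y. {x, y} \<in> edges G}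
             \<union> {{Copy x, Apex} | x. x \<in> verts G} \<rparr>"

end

theory Submission
  imports Defs
begin

text \<open>
  If some class \<open>C\<close> of a total dominator coloring of \<open>G\<close> has no private neighbor, put the apex into
  \<open>C\<close> and let all copies form one new class. Conversely, let a total dominator coloring of the
  Mycielskian be given; the apex dominates a class consisting of copies only.

  If the apex is not a class of its own, then every copy dominates a class without copies that
  contains an original vertex, so the restriction to \<open>G\<close> is a total dominator coloring with at least
  one color less. If exactly one color is lost, then either some remaining class contains a copy and
  is not needed, or all copies have the same color and the class of the apex is not needed.

  If the apex is a class of its own, choose a representative of each class consisting of copies only
  and make its original a singleton class of \<open>G\<close>. Again a color is lost, and a class from which a
  representative was removed is not needed, as whoever dominated it is adjacent to that
  representative.
\<close>

section \<open>Adjacency in \<open>G\<close> and in its Mycielskian\<close>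

lemma adj_irrefl: "simple_graph G \<Longrightarrow> \<not> adj G v v"
  by (auto simp: adj_def simple_graph_def)

lemma adj_verts:
  assumes "simple_graph G" "adj G u v"
  shows "u \<in> verts G" "v \<in> verts G"
  using assms by (auto simp: adj_def simple_graph_def)

lemma adj_mycielskian [simp]:
  "adj (mycielskian G) (Orig x) (Orig y) \<longleftrightarrow> adj G x y"
  "adj (mycielskian G) (Copy x) (Orig y) \<longleftrightarrow> adj G x y"
  "adj (mycielskian G) (Orig x) (Copy y) \<longleftrightarrow> adj G x y"
  "adj (mycielskian G) (Copy x) Apex \<longleftrightarrow> x \<in> verts G"
  "adj (mycielskian G) Apex (Copy x) \<longleftrightarrow> x \<in> verts G"
  "\<not> adj (mycielskian G) (Copy x) (Copy y)"
  "\<not> adj (mycielskian G) (Orig x) Apex"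
  "\<not> adj (mycielskian G) Apex (Orig x)"
  "\<not> adj (mycielskian G) Apex Apex"
  by (auto simp: adj_def mycielskian_def doubleton_eq_iff insert_commute)

lemma verts_mycielskian: "verts (mycielskian G) = Orig ` verts G \<union> Copy ` verts G \<union> {Apex}"
  by (simp add: mycielskian_def)

lemma adj_exists_if_min_degree:
  assumes "simple_graph G" "min_degree G \<ge> 1" "v \<in> verts G"
  shows "\<exists>u. adj G v u"
proof -
  have "min_degree G \<le> degree G v"
    using assms by (simp add: min_degree_def simple_graph_def)
  then have "card {u \<in> verts G. adj G v u} \<noteq> 0"
    using assms(2) by (simp add: degree_def)
  then have "{u \<in> verts G. adj G v u} \<noteq> {}" by (metis card.empty)
  then show ?thesis by blast
qed

section \<open>Minimum total dominator colorings\<close>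

lemma td_chromatic_number_le:
  "total_dominator_coloring G f \<Longrightarrow> td_chromatic_number G \<le> card f"
  unfolding td_chromatic_number_def by (rule Least_le) blast

text \<open>The partition into singletons is a total dominator coloring, so the \<open>LEAST\<close>
  in \<open>td_chromatic_number\<close> is attained.\<close>

lemma min_td_coloring_exists:
  assumes "\<And>v. v \<in> verts G \<Longrightarrow> \<exists>u\<in>verts G. adj G v u" and "\<And>v. \<not> adj G v v"
  shows "\<exists>f. min_td_coloring G f"
proof -
  let ?f = "(\<lambda>v. {v}) ` verts G"
  have "partition_on (verts G) ?f"
    by (rule partition_on_singletons)
  then have "total_dominator_coloring G ?f"
    using assms by (auto simp: total_dominator_coloring_def proper_coloring_def dominates_def)
  then have "\<exists>k f. total_dominator_coloring G f \<and> card f = k" by blast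
  from LeastI_ex[OF this] show ?thesis
    by (auto simp: min_td_coloring_def td_chromatic_number_def)
qed

lemma finite_total_dominator_coloring:
  "finite (verts G) \<Longrightarrow> total_dominator_coloring G f \<Longrightarrow> finite f"
  by (auto simp: total_dominator_coloring_def proper_coloring_def intro: finite_elements)

lemma private_neighbors_emptyI:
  assumes "\<And>v. v \<in> verts G \<Longrightarrow> \<exists>D\<in>f. D \<noteq> C \<and> dominates G v D"
  shows "private_neighbors G C f = {}"
  using assms by (auto simp: private_neighbors_def)

section \<open>From colorings of \<open>G\<close> to colorings of the Mycielskian\<close>

lemma total_dominator_coloring_mycielskian:
  assumes "simple_graph G" "verts G \<noteq> {}" and f: "total_dominator_coloring G f"
    and C: "C \<in> f" "private_neighbors G C f = {}"
  shows "\<exists>h. total_dominator_coloring (mycielskian G) h \<and> card h \<le> card f + 1"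
proof -
  let ?V = "verts G"
  define h where "h = (`) Orig ` (f - {C}) \<union> {insert Apex (Orig ` C), Copy ` ?V}"
  have p: "partition_on ?V f" and ind: "\<And>C u v. C \<in> f \<Longrightarrow> u \<in> C \<Longrightarrow> v \<in> C \<Longrightarrow> \<not> adj G u v"
    and dom: "\<And>v. v \<in> ?V \<Longrightarrow> \<exists>D\<in>f. dominates G v D"
    using f by (auto simp: total_dominator_coloring_def proper_coloring_def)
  have disj: "A \<in> f \<Longrightarrow> B \<in> f \<Longrightarrow> x \<in> A \<Longrightarrow> x \<in> B \<Longrightarrow> A = B" for A B x
    using partition_onD2[OF p] by (auto simp: disjoint_def)
  have un: "\<Union>f = ?V" using partition_onD1[OF p] by simp
  have ne: "{} \<notin> f" using partition_onD3[OF p] by simp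
  have "partition_on (verts (mycielskian G)) h"
  proof (rule partition_onI)
    have "\<Union> ((`) Orig ` (f - {C})) \<union> Orig ` C = Orig ` \<Union>f"
      using C(1) by (auto simp: image_iff)
    moreover have "\<Union>h = (\<Union> ((`) Orig ` (f - {C})) \<union> Orig ` C) \<union> Copy ` ?V \<union> {Apex}"
      by (simp add: h_def Un_ac)
    ultimately show "\<Union>h = verts (mycielskian G)"
      by (simp only: un verts_mycielskian)
    show "{} \<notin> h"
      using ne assms(2) unfolding h_def by auto
    show "disjnt q q'" if "q \<in> h" "q' \<in> h" "q \<noteq> q'" for q q'
    proof -
      have "disjnt (Orig ` A) (Orig ` B)" if "A \<in> f" "B \<in> f" "A \<noteq> B" for A B
        using disj[OF that(1,2)] that(3) by (auto simp: disjnt_iff)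
      then show ?thesis
        using that C(1) unfolding h_def by (auto simp: disjnt_iff image_iff)
    qed
  qed
  moreover have "\<not> adj (mycielskian G) u v" if "D \<in> h" "u \<in> D" "v \<in> D" for D u v
    using that ind C(1) unfolding h_def by auto
  moreover have "\<exists>D\<in>h. dominates (mycielskian G) v D"
    if v: "v \<in> verts (mycielskian G)" for v
  proof (cases "v = Apex")
    case True
    have "Copy ` ?V \<in> h" by (simp add: h_def)
    then show ?thesis using True by (intro bexI[of _ "Copy ` ?V"]) (auto simp: dominates_def)
  next
    case False
    then obtain x where x: "x \<in> ?V" "v = Orig x \<or> v = Copy x"
      using v by (auto simp: verts_mycielskian)
    \<comment> \<open>As \<open>x\<close> is not a private neighbor of \<open>C\<close>, it
      dominates a class that stays free of the apex. \<open>Orig x\<close> and \<open>Copy x\<close>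
      have the same original neighbors, so this class serves both.\<close>
    obtain D where D: "D \<in> f" "D \<noteq> C" "dominates G x D"
      using dom[OF x(1)] C x(1) by (auto simp: private_neighbors_def)
    then have "dominates (mycielskian G) v (Orig ` D)" "Orig ` D \<in> h"
      using x(2) by (auto simp: dominates_def h_def)
    then show ?thesis by blast
  qed
  moreover have "card h \<le> card f + 1"
  proof -
    have fin: "finite f"
      using assms(1) f by (auto simp: simple_graph_def intro: finite_total_dominator_coloring)
    have "card h \<le> card ((`) Orig ` (f - {C})) + card {insert Apex (Orig ` C), Copy ` ?V}"
      unfolding h_def by (rule card_Un_le)
    also have "\<dots> \<le> card (f - {C}) + 2"
      using fin by (intro add_mono card_image_le) (auto simp: card_insert_if)
    also have "\<dots> = card f + 1"
      using fin C(1) card_Suc_Diff1[OF fin C(1)] by simp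
    finally show ?thesis .
  qed
  ultimately show ?thesis
    by (auto simp: total_dominator_coloring_def proper_coloring_def)
qed

section \<open>From colorings of the Mycielskian to colorings of \<open>G\<close>\<close>

text \<open>Removing \<open>S\<close> from all classes and dropping those that become empty
  partitions \<open>A - S\<close>; the singletons of \<open>S\<close> complete this to a partition
  of \<open>A\<close>.\<close>

lemma partition_on_isolate:
  assumes "partition_on A P" and "S \<subseteq> A"
  shows "partition_on A ((\<lambda>D. D - S) ` P - {{}} \<union> (\<lambda>s. {s}) ` S)"
proof -
  have P: "partition_on (A - S) ((\<lambda>D. D - S) ` P - {{}})" (is "partition_on _ ?P")
    by (rule partition_on_transform[OF assms(1)]) (auto simp: disjnt_def)
  have "disjoint (?P \<union> (\<lambda>s. {s}) ` S)"
    using partition_onD2[OF P] partition_onD1[OF P, symmetric]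
    by (intro disjoint_union) (auto simp: disjoint_def)
  moreover have "\<Union> (?P \<union> (\<lambda>s. {s}) ` S) = A"
    using assms(2) by (simp only: Union_Un_distrib partition_onD1[OF P, symmetric]) auto
  ultimately show ?thesis by (auto simp: partition_on_def)
qed

text \<open>Both claims concern the same \<open>f\<close>: the strict inequality yields the lower
  bound for the Mycielskian, and the last clause yields Class 1 when that bound is attained.\<close>

lemma total_dominator_coloring_of_mycielskian:
  assumes G: "simple_graph G" and g: "total_dominator_coloring (mycielskian G) g"
  shows "\<exists>f. total_dominator_coloring G f \<and> card f < card g \<and>
    (card f + 1 = card g \<longrightarrow> (\<exists>C\<in>f. private_neighbors G C f = {}))"
proof -
  let ?V = "verts G" and ?M = "mycielskian G"
  \<comment> \<open>\<open>R D\<close> is the trace of a class on the original vertices; it may be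
    empty.\<close>
  define R :: "'a myc_vertex set \<Rightarrow> 'a set" where "R D = Orig -` D" for D
  have p: "partition_on (verts ?M) g"
    and ind: "\<And>D u v. D \<in> g \<Longrightarrow> u \<in> D \<Longrightarrow> v \<in> D \<Longrightarrow> \<not> adj ?M u v"
    and dom: "\<And>v. v \<in> verts ?M \<Longrightarrow> \<exists>D\<in>g. dominates ?M v D"
    using g by (auto simp: total_dominator_coloring_def proper_coloring_def)
  have disj: "A = B" if "A \<in> g" "B \<in> g" "x \<in> A" "x \<in> B" for A B x
    using partition_onD2[OF p] that by (auto simp: disjoint_def)
  have un: "\<Union>g = verts ?M" using partition_onD1[OF p] by simp
  have ne: "D \<noteq> {}" if "D \<in> g" for D using partition_onD3[OF p] that by auto
  have finV: "finite ?V" using G by (simp add: simple_graph_def)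
  then have fing: "finite g"
    using g by (intro finite_total_dominator_coloring[of ?M]) (simp_all add: verts_mycielskian)
  have RV: "Orig -` verts ?M = ?V" by (auto simp: verts_mycielskian)
  have domR: "dominates G x (R D)" if "dominates ?M (Orig x) D \<or> dominates ?M (Copy x) D" for x D
    using that by (auto simp: dominates_def R_def)
  obtain C0 where C0: "C0 \<in> g" "dominates ?M Apex C0"
    using dom[of Apex] by (auto simp: verts_mycielskian)
  have C0_sub: "C0 \<subseteq> range Copy"
  proof
    fix v assume "v \<in> C0"
    then show "v \<in> range Copy" using C0(2) by (cases v) (auto simp: dominates_def)
  qed
  \<comment> \<open>\<open>S\<close> is empty if the apex shares its class, and consists of the
    chosen representatives otherwise.\<close>
  define f where "f S = (\<lambda>D. R D - S) ` g - {{}} \<union> (\<lambda>s. {s}) ` S" for S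
  have part: "partition_on ?V (f S)" if "S \<subseteq> ?V" for S
  proof -
    have eq: "(\<lambda>D. D - S) ` (R ` g - {{}}) - {{}} = (\<lambda>D. R D - S) ` g - {{}}" by auto
    have "partition_on ?V (R ` g - {{}})"
      using partition_on_vimage[OF p, of Orig] unfolding RV R_def .
    from partition_on_isolate[OF this that] show ?thesis unfolding eq f_def .
  qed
  have indf: "\<not> adj G u v" if "C \<in> f S" "u \<in> C" "v \<in> C" for S C u v
    using that ind[of _ "Orig u" "Orig v"] adj_irrefl[OF G] by (auto simp: f_def R_def)
  have tdcI: "total_dominator_coloring G (f S)"
    if "S \<subseteq> ?V" "\<And>x. x \<in> ?V \<Longrightarrow> \<exists>C\<in>f S. dominates G x C" for S
    unfolding total_dominator_coloring_def proper_coloring_def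
    using part[OF that(1)] indf[of _ S] that(2) by blast
  show ?thesis
  proof (cases "{Apex} \<in> g")
    case False
    have f_eq: "f {} = R ` g - {{}}" by (simp add: f_def)
    have copy: "\<exists>D\<in>g. Copy ` ?V \<inter> D = {} \<and> R D \<noteq> {} \<and> dominates G x (R D)"
      if x: "x \<in> ?V" for x
    proof -
      obtain D where D: "D \<in> g" "dominates ?M (Copy x) D"
        using dom[of "Copy x"] x by (auto simp: verts_mycielskian)
      \<comment> \<open>A copy is adjacent only to originals and the apex, so a dominated class
        without originals would be \<open>{Apex}\<close>.\<close>
      have "R D \<noteq> {}"
      proof
        assume "R D = {}"
        then have "v = Apex" if "v \<in> D" for v
          using that D(2) by (cases v) (auto simp: dominates_def R_def)
        then have "D = {Apex}" using ne[OF D(1)] by blast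
        then show False using False D(1) by simp
      qed
      moreover have "Copy ` ?V \<inter> D = {}" using D(2) by (auto simp: dominates_def)
      ultimately show ?thesis using D domR by blast
    qed
    have tdc: "total_dominator_coloring G (f {})"
    proof (rule tdcI)
      show "\<exists>C\<in>f {}. dominates G x C" if "x \<in> ?V" for x
        using copy[OF that] unfolding f_eq by blast
    qed simp
    have le: "card (f {}) \<le> card (g - X)" if "X \<subseteq> g" "\<And>D. D \<in> X \<Longrightarrow> R D = {}" for X
    proof -
      have "f {} \<subseteq> R ` (g - X)" using that unfolding f_eq by auto
      then show ?thesis using fing
        by (meson card_image_le card_mono finite_Diff finite_imageI le_trans)
    qed
    have RC0: "R C0 = {}" using C0_sub by (auto simp: R_def)
    have "card (f {}) < card g"
      using le[of "{C0}"] C0(1) RC0 fing card_Diff1_less[OF fing C0(1)] by simp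
    moreover have "\<exists>C\<in>f {}. private_neighbors G C (f {}) = {}" if eq: "card (f {}) + 1 = card g"
    proof -
      \<comment> \<open>A second class with empty trace besides \<open>C0\<close> would cost a
        second color.\<close>
      have meets: "R D \<noteq> {}" if D: "D \<in> g" "D \<noteq> C0" for D
      proof
        assume "R D = {}"
        then have "card (f {}) \<le> card (g - {C0, D})" using le[of "{C0, D}"] D C0(1) RC0 by auto
        also have "\<dots> = card g - 2" using fing D C0(1) by (subst card_Diff_subset) auto
        finally show False using eq card_mono[OF fing, of "{C0, D}"] D C0(1) by simp
      qed
      have neq: "R D \<noteq> R D'" if "D \<in> g" "D' \<in> g" "D \<noteq> D'" "R D \<noteq> {}" for D D'
      proof -
        from \<open>R D \<noteq> {}\<close> obtain y where "y \<in> R D" by blast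
        then show ?thesis using disj[OF that(1,2), of "Orig y"] that(3) by (auto simp: R_def)
      qed
      show ?thesis
      proof (cases "\<exists>D\<in>g. R D \<noteq> {} \<and> Copy ` ?V \<inter> D \<noteq> {}")
        case True
        then obtain D where D: "D \<in> g" "R D \<noteq> {}" "Copy ` ?V \<inter> D \<noteq> {}" by blast
        have "private_neighbors G (R D) (f {}) = {}"
        proof (rule private_neighbors_emptyI)
          fix x assume "x \<in> ?V"
          from copy[OF this] obtain D' where
            D': "D' \<in> g" "Copy ` ?V \<inter> D' = {}" "R D' \<noteq> {}" "dominates G x (R D')" by blast
          then have "R D' \<noteq> R D" using neq D by metis
          then show "\<exists>E\<in>f {}. E \<noteq> R D \<and> dominates G x E" using D' unfolding f_eq by blast
        qed
        then show ?thesis using D unfolding f_eq by blast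
      next
        case nomix: False
        \<comment> \<open>Every class except \<open>C0\<close> meets the originals and hence has no
          copies, so all copies lie in \<open>C0\<close>. Thus \<open>Orig x\<close> dominates
          neither \<open>C0\<close>, which contains \<open>Copy x\<close>, nor the class
          \<open>W\<close> of the apex.\<close>
        have "Apex \<in> \<Union>g" unfolding un by (simp add: verts_mycielskian)
        then obtain W where W: "W \<in> g" "Apex \<in> W" by blast
        then have RW: "R W \<noteq> {}" using meets[OF W(1)] C0_sub by auto
        have "private_neighbors G (R W) (f {}) = {}"
        proof (rule private_neighbors_emptyI)
          fix x assume x: "x \<in> ?V"
          then obtain D where D: "D \<in> g" "dominates ?M (Orig x) D"
            using dom[of "Orig x"] by (auto simp: verts_mycielskian)
          have "Copy x \<in> \<Union>g" unfolding un using x by (simp add: verts_mycielskian)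
          then obtain B where B: "B \<in> g" "Copy x \<in> B" by blast
          then have "B = C0" using nomix meets x by blast
          then have "D \<noteq> C0" using D B adj_irrefl[OF G] by (auto simp: dominates_def)
          moreover have "D \<noteq> W" using D W by (auto simp: dominates_def)
          ultimately have "R D \<noteq> {}" "R D \<noteq> R W" using meets neq D(1) W(1) RW by metis+
          then show "\<exists>E\<in>f {}. E \<noteq> R W \<and> dominates G x E"
            using D domR unfolding f_eq by blast
        qed
        then show ?thesis using W RW unfolding f_eq by blast
      qed
    qed
    ultimately show ?thesis using tdc by blast
  next
    case True
    define E where "E = {D \<in> g. D \<subseteq> range Copy}"
    define Q where "Q = {D \<in> g. R D \<noteq> {}}"
    have "\<exists>x. Copy x \<in> D" if "D \<in> E" for D
      using that ne[of D] by (auto simp: E_def)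
    then obtain j where j: "Copy (j D) \<in> D" if "D \<in> E" for D by metis
    define S where "S = j ` E"
    have SV: "S \<subseteq> ?V"
    proof -
      have "j D \<in> ?V" if "D \<in> E" for D
      proof -
        have "Copy (j D) \<in> \<Union>g" using j[OF that] that by (auto simp: E_def)
        then show ?thesis unfolding un by (auto simp: verts_mycielskian)
      qed
      then show ?thesis by (auto simp: S_def)
    qed
    have fin: "finite E" "finite Q" using fing by (auto simp: E_def Q_def)
    have dis: "E \<inter> Q = {}" "{Apex} \<notin> E \<union> Q" "insert {Apex} (E \<union> Q) \<subseteq> g"
      using True by (auto simp: E_def Q_def R_def)
    \<comment> \<open>The \<open>1\<close> counts \<open>{Apex}\<close>, the color that is
      lost.\<close>
    have card_EQ: "card E + card Q + 1 \<le> card g"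
    proof -
      have "card (insert {Apex} (E \<union> Q)) = card E + card Q + 1"
        using dis fin by (simp add: card_Un_disjoint)
      then show ?thesis using card_mono[OF fing dis(3)] by simp
    qed
    \<comment> \<open>\<open>Q' = Q\<close> gives the strict inequality; omitting one class from
      \<open>Q\<close> shows later that this class does not vanish when equality holds.\<close>
    have le: "card (f S) \<le> card Q' + card E"
      if "Q' \<subseteq> Q" "\<And>D. D \<in> Q - Q' \<Longrightarrow> R D - S = {}" for Q'
    proof -
      have "f S \<subseteq> (\<lambda>D. R D - S) ` Q' \<union> (\<lambda>D. {j D}) ` E"
      proof
        fix C assume "C \<in> f S"
        then consider D where "D \<in> g" "C = R D - S" "C \<noteq> {}" | D where "D \<in> E" "C = {j D}"
          by (auto simp: f_def S_def)
        then show "C \<in> (\<lambda>D. R D - S) ` Q' \<union> (\<lambda>D. {j D}) ` E"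
        proof cases
          case 1
          then have "D \<in> Q" by (auto simp: Q_def)
          then have "D \<in> Q'" using that(2)[of D] 1 by blast
          then show ?thesis using 1 by blast
        qed blast
      qed
      moreover have "finite Q'" using that(1) fin by (auto intro: finite_subset)
      ultimately have "card (f S) \<le> card ((\<lambda>D. R D - S) ` Q' \<union> (\<lambda>D. {j D}) ` E)"
        using fin by (intro card_mono) auto
      also have "\<dots> \<le> card ((\<lambda>D. R D - S) ` Q') + card ((\<lambda>D. {j D}) ` E)"
        by (rule card_Un_le)
      also have "\<dots> \<le> card Q' + card E"
        using fin \<open>finite Q'\<close> by (intro add_mono card_image_le)
      finally show ?thesis .
    qed
    \<comment> \<open>A dominated class in \<open>E\<close> contains the copy of some
      \<open>s\<close> in \<open>S\<close>. Any other dominated class contains an original, since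
      \<open>Orig x\<close> is not adjacent to the apex; its trace either meets \<open>S\<close> or
      survives unchanged.\<close>
    have orig: "(\<exists>s\<in>S. adj G x s) \<or> (\<exists>D\<in>Q. R D \<inter> S = {} \<and> dominates G x (R D))"
      if x: "x \<in> ?V" for x
    proof -
      obtain D where D: "D \<in> g" "dominates ?M (Orig x) D"
        using dom[of "Orig x"] x by (auto simp: verts_mycielskian)
      show ?thesis
      proof (cases "D \<in> E")
        case True
        then have "adj ?M (Orig x) (Copy (j D))"
          using D(2) j[OF True] unfolding dominates_def by blast
        then show ?thesis using True by (auto simp: S_def)
      next
        case False
        then obtain v where v: "v \<in> D" "v \<notin> range Copy" using D(1) by (auto simp: E_def)
        then have "R D \<noteq> {}" using D(2) by (cases v) (auto simp: dominates_def R_def)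
        then have "D \<in> Q" using D(1) by (simp add: Q_def)
        then show ?thesis using domR[of x D] D(2)
          by (cases "R D \<inter> S = {}")
          (auto simp: dominates_def)
      qed
    qed
    \<comment> \<open>The dominated class can be taken inside \<open>S\<close> or as an unchanged
      trace, never as the remainder of a class that lost a vertex to \<open>S\<close>.\<close>
    have domS: "\<exists>C\<in>f S. (C \<subseteq> S \<or> (\<exists>D\<in>Q. R D \<inter> S = {} \<and> C = R D)) \<and> dominates G x C"
      if "x \<in> ?V" for x
      using orig[OF that]
    proof
      assume "\<exists>s\<in>S. adj G x s"
      then obtain s where "s \<in> S" "adj G x s" by blast
      then show ?thesis by (intro bexI[of _ "{s}"]) (auto simp: dominates_def f_def)
    next
      assume "\<exists>D\<in>Q. R D \<inter> S = {} \<and> dominates G x (R D)"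
      then obtain D where D: "D \<in> Q" "R D \<inter> S = {}" "dominates G x (R D)" by blast
      then have "R D = R D - S" "R D \<noteq> {}" "D \<in> g" by (auto simp: Q_def)
      then have "R D \<in> f S" unfolding f_def by blast
      then show ?thesis using D by blast
    qed
    have tdc: "total_dominator_coloring G (f S)"
      using SV by (rule tdcI) (use domS in blast)
    have "card (f S) < card g" using le[of Q] card_EQ by simp
    moreover have "\<exists>C\<in>f S. private_neighbors G C (f S) = {}" if eq: "card (f S) + 1 = card g"
    proof -
      \<comment> \<open>\<open>C0\<close> makes \<open>S\<close> nonempty, so some class
        \<open>D1\<close> loses a vertex; its remainder will be the class without private
        neighbors.\<close>
      have "j C0 \<in> S" using C0(1) C0_sub by (auto simp: S_def E_def)
      then have "Orig (j C0) \<in> \<Union>g" unfolding un using SV by (auto simp: verts_mycielskian)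
      then obtain D1 where D1: "D1 \<in> g" "Orig (j C0) \<in> D1" by blast
      then have D1Q: "D1 \<in> Q" by (auto simp: Q_def R_def)
      have ne1: "R D1 - S \<noteq> {}"
      proof
        assume "R D1 - S = {}"
        then have "card (f S) \<le> card (Q - {D1}) + card E" by (intro le) auto
        then show False using eq card_EQ card_Diff1_less[OF fin(2) D1Q] by simp
      qed
      have "private_neighbors G (R D1 - S) (f S) = {}"
      proof (rule private_neighbors_emptyI)
        fix x assume "x \<in> ?V"
        from domS[OF this] obtain C where C: "C \<in> f S" "dominates G x C"
          "C \<subseteq> S \<or> (\<exists>D\<in>Q. R D \<inter> S = {} \<and> C = R D)" by blast
        \<comment> \<open>The remainder is nonempty and disjoint from \<open>S\<close>, so it is not
          inside \<open>S\<close>. An unchanged trace equal to it would share a vertex with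
          \<open>D1\<close> and so come from \<open>D1\<close>, which meets
          \<open>S\<close>.\<close>
        have "C \<noteq> R D1 - S"
        proof
          assume C_eq: "C = R D1 - S"
          then obtain D where D: "D \<in> Q" "R D \<inter> S = {}" "R D = R D1 - S"
            using C(3) ne1 by blast
          then obtain y where "y \<in> R D" "y \<in> R D1" using ne1 by blast
          then have "D = D1" using disj D(1) D1(1) by (auto simp: R_def Q_def)
          then show False using D(2) D1(2) \<open>j C0 \<in> S\<close> by (auto simp: R_def)
        qed
        then show "\<exists>D\<in>f S. D \<noteq> R D1 - S \<and> dominates G x D" using C by blast
      qed
      moreover have "R D1 - S \<in> f S" using ne1 D1(1) by (auto simp: f_def)
      ultimately show ?thesis by blast
    qed
    ultimately show ?thesis using tdc by blast
  qed
qed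

section \<open>The equivalence\<close>

theorem theorem2p3:
  fixes G :: "'a ugraph"
  assumes "simple_graph G" and "verts G \<noteq> {}" and "min_degree G \<ge> 1"
  shows "class1 G \<longleftrightarrow>
    td_chromatic_number (mycielskian G) = td_chromatic_number G + 1"
proof -
  let ?M = "mycielskian G"
  have nbr: "\<exists>u\<in>verts G. adj G v u" if "v \<in> verts G" for v
    using adj_exists_if_min_degree[OF assms(1,3) that] adj_verts[OF assms(1)] by blast
  \<comment> \<open>The Mycielskian inherits the absence of isolated vertices, so it has a minimum
    coloring \<open>g\<close>.\<close>
  have "\<exists>u\<in>verts ?M. adj ?M v u" if v: "v \<in> verts ?M" for v
  proof (cases v)
    case (Orig x)
    then obtain u where "u \<in> verts G" "adj G x u" using nbr v by (auto simp: verts_mycielskian)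
    then show ?thesis using Orig by (intro bexI[of _ "Orig u"]) (auto simp: verts_mycielskian)
  next
    case (Copy x)
    then obtain u where "u \<in> verts G" "adj G x u" using nbr v by (auto simp: verts_mycielskian)
    then show ?thesis using Copy by (intro bexI[of _ "Orig u"]) (auto simp: verts_mycielskian)
  next
    case Apex
    obtain x where "x \<in> verts G" using assms(2) by blast
    then show ?thesis using Apex by (intro bexI[of _ "Copy x"]) (auto simp: verts_mycielskian)
  qed
  moreover have "\<not> adj ?M v v" for v
    using adj_irrefl[OF assms(1)] by (cases v) auto
  ultimately obtain g where g: "min_td_coloring ?M g"
    using min_td_coloring_exists by metis
  then obtain f where f: "total_dominator_coloring G f" "card f < card g"
    "card f + 1 = card g \<longrightarrow> (\<exists>C\<in>f. private_neighbors G C f = {})"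
    using total_dominator_coloring_of_mycielskian[OF assms(1)] by (metis min_td_coloring_def)
  have card_g: "card g = td_chromatic_number ?M" using g by (simp add: min_td_coloring_def)
  have le: "td_chromatic_number G \<le> card f" using f(1) by (rule td_chromatic_number_le)
  show ?thesis
  proof
    assume "class1 G"
    then obtain f' C where f': "total_dominator_coloring G f'" "card f' = td_chromatic_number G"
      and C: "C \<in> f'" "private_neighbors G C f' = {}"
      by (auto simp: class1_def min_td_coloring_def)
    obtain h where "total_dominator_coloring ?M h" "card h \<le> card f' + 1"
      using total_dominator_coloring_mycielskian[OF assms(1,2) f'(1) C] by blast
    then have "td_chromatic_number ?M \<le> td_chromatic_number G + 1"
      using td_chromatic_number_le[of ?M h] f'(2) by simp
    then show "td_chromatic_number ?M = td_chromatic_number G + 1"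
      using le f(2) card_g by simp
  next
    assume "td_chromatic_number ?M = td_chromatic_number G + 1"
    \<comment> \<open>\<open>card f\<close> is at least the chromatic number of \<open>G\<close> and
      less than that number plus one, so \<open>f\<close> is minimum.\<close>
    then have "card f = td_chromatic_number G" "card f + 1 = card g"
      using le f(2) card_g by simp_all
    then show "class1 G" using f by (auto simp: class1_def min_td_coloring_def)
  qed
qed

end
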